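(* Let $G$ be a finite simple digraph on $n$ vertices in which every vertex has out-degree $1$ or $2$, and let $p$ be the number of vertices of out-degree $1$. Then there exist directed cycles $C_1,C_2$ in $G$ (not necessarily distinct) such that $|V(C_1)\cap V(C_2)|\le p+1$.
   Context: A simple digraph has no loops and no parallel edges (oppositely oriented edges between two vertices are allowed). *)

theory Defs
  imports "Graph_Theory.Arc_Walk"
begin

(* A cycle of Graph_Theory is a nonempty list of arcs. Every vertex on it is the tail of
   exactly one of these arcs, so the tails are exactly its vertices. *)
definition cycle_verts :: "('a, 'b) pre_digraph \<Rightarrow> 'b list \<Rightarrow> 'a set" where
  "cycle_verts G C = tail G ` set C"

lemma (in wf_digraph) cycle_verts_eq_awalk_verts:
  assumes "awalk u C u" and "C \<noteq> []"
  shows "cycle_verts G C = set (awalk_verts u C)"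
proof -
  have "set (awalk_verts u C) = insert (awlast u C) (tail G ` set C)"
    using assms(2) by (auto simp: awalk_verts_conv)
  moreover have "awlast u C = u" using assms(1) by simp
  moreover have "u = tail G (hd C)" using assms by (simp add: awalk_def cas_simp)
  ultimately show ?thesis using assms(2) by (auto simp: cycle_verts_def)
qed

end

theory Submission
  imports Defs "Graph_Theory.Digraph_Component"
begin

text \<open>Suppose first that all out-degrees are at least 2; we may also assume strong connectivity. If two
  cycles meeting only in \<open>v\<close> do not exist, then by Menger's theorem some \<open>x \<noteq> v\<close> lies on every
  closed walk through \<open>v\<close>. If this happens for every \<open>v\<close>, then, this domination being transitive,
  some \<open>v \<noteq> x\<close> dominate each other. The vertices that \<open>v\<close> reaches avoiding \<open>x\<close>, and
  those that \<open>x\<close> reaches avoiding \<open>v\<close>, then form disjoint sets, and each induces a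
  subgraph without sinks, hence contains a cycle. The general case reduces to this one by
  duplicating the out-neighbours of the vertices of out-degree 1. Below, a vertex set \<open>X\<close>
  contains the vertices of a cycle iff \<open>Restr E X\<close> is not acyclic.\<close>

section \<open>Walks as vertex lists: cutting and splicing\<close>

text \<open>A single vertex of \<open>A\<close> \<inter> \<open>B\<close> counts as a walk, as the
  vertex form of Menger's theorem demands. Vertices may repeat, so splicing never requires
  shortening to a path.\<close>

definition walk_betw :: "('a \<times> 'a) set \<Rightarrow> 'a set \<Rightarrow> 'a set \<Rightarrow> 'a list \<Rightarrow> bool" where
  "walk_betw E A B xs \<longleftrightarrow>
     xs \<noteq> [] \<and> successively (\<lambda>a b. (a, b) \<in> E) xs \<and> hd xs \<in> A \<and> last xs \<in> B"

lemma walk_betw_append: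
  assumes "walk_betw E A B xs" "walk_betw E C D ys" "(last xs, hd ys) \<in> E"
  shows "walk_betw E A D (xs @ ys)"
  using assms by (auto simp: walk_betw_def successively_append_iff)

lemma walk_betw_mono:
  assumes "walk_betw E A B xs" "E \<subseteq> F"
  shows "walk_betw F A B xs"
  using assms by (auto simp: walk_betw_def elim: successively_mono)

text \<open>Using the arc \<open>(x, y)\<close> means leaving \<open>x\<close>, hence having
  \<open>x\<close> before the last position. The end \<open>q\<close> itself may be
  \<open>x\<close>, which is the case needed after cutting a walk at its first visit to
  \<open>x\<close>.\<close>

lemma walk_betw_avoid_tail:
  assumes "walk_betw (insert (x, y) E) A B (us @ [q])" "x \<notin> set us"
  shows "walk_betw E A B (us @ [q])"
proof -
  have "successively (\<lambda>a b. (a, b) \<in> insert (x, y) E) (us @ [q]) \<Longrightarrow> x \<notin> set us \<Longrightarrow>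
    successively (\<lambda>a b. (a, b) \<in> E) (us @ [q])"
    by (induction us) (auto simp: successively_Cons hd_append split: if_splits)
  with assms show ?thesis by (auto simp: walk_betw_def)
qed

lemma walk_betw_avoid_head:
  assumes "walk_betw (insert (x, y) E) A B (q # vs)" "y \<notin> set vs"
  shows "walk_betw E A B (q # vs)"
proof -
  have "successively (\<lambda>a b. (a, b) \<in> insert (x, y) E) (q # vs) \<Longrightarrow> y \<notin> set vs \<Longrightarrow>
    successively (\<lambda>a b. (a, b) \<in> E) (q # vs)"
    by (induction vs arbitrary: q) auto
  with assms show ?thesis by (auto simp: walk_betw_def)
qed

lemma walk_betw_first:
  assumes "walk_betw E A B xs" "set xs \<inter> P \<noteq> {}"
  obtains us q where "walk_betw E A P (us @ [q])" "q \<in> P" "set us \<inter> P = {}"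
    "set (us @ [q]) \<subseteq> set xs"
proof -
  have "\<exists>x\<in>set xs. x \<in> P" using assms(2) by blast
  then obtain us q vs where "xs = us @ q # vs" "q \<in> P" "\<forall>u\<in>set us. u \<notin> P"
    using split_list_first_prop[of xs "\<lambda>x. x \<in> P"] by blast
  then show thesis
    using assms(1) by (intro that[of us q]) (auto simp: walk_betw_def successively_append_iff hd_append)
qed

lemma walk_betw_last:
  assumes "walk_betw E A B xs" "set xs \<inter> P \<noteq> {}"
  obtains q vs where "walk_betw E P B (q # vs)" "q \<in> P" "set vs \<inter> P = {}"
    "set (q # vs) \<subseteq> set xs"
proof -
  have "\<exists>x\<in>set xs. x \<in> P" using assms(2) by blast
  then obtain us q vs where "xs = us @ q # vs" "q \<in> P" "\<forall>u\<in>set vs. u \<notin> P"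
    using split_list_last_prop[of xs "\<lambda>x. x \<in> P"] by blast
  then show thesis
    using assms(1) by (intro that[of q vs]) (auto simp: walk_betw_def successively_append_iff)
qed

text \<open>Follow \<open>xs\<close> to a common vertex, then continue along
  \<open>ys\<close>.\<close>

lemma walk_betw_switch:
  assumes "walk_betw E A B xs" "walk_betw E C D ys" "set xs \<inter> set ys \<noteq> {}"
  shows "\<exists>zs. walk_betw E A D zs \<and> set zs \<subseteq> set xs \<union> set ys"
proof -
  obtain t where t: "t \<in> set xs" "t \<in> set ys" using assms(3) by blast
  obtain as as' where xs: "xs = as @ t # as'" using t(1) by (meson split_list)
  obtain bs bs' where ys: "ys = bs @ t # bs'" using t(2) by (meson split_list)
  have "walk_betw E A D (as @ t # bs')"
    using assms(1,2) xs ys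
    by (auto simp: walk_betw_def successively_append_iff hd_append split: if_splits)
  then show ?thesis using xs ys by fastforce
qed

text \<open>Menger's theorem for two paths, along the lines of Goering's short proof.\<close>

theorem two_disjoint_walks:
  assumes "finite E" "\<And>u. \<exists>xs. walk_betw E A B xs \<and> u \<notin> set xs"
  shows "\<exists>xs ys. walk_betw E A B xs \<and> walk_betw E A B ys \<and> set xs \<inter> set ys = {}"
  using assms
proof (induction E arbitrary: A B rule: finite_induct)
  case empty
  have single: "\<exists>a. xs = [a]" if "walk_betw {} A B xs" for xs
    using that by (cases xs rule: remdups_adj.cases) (auto simp: walk_betw_def)
  obtain xs where xs: "walk_betw {} A B xs" using empty by blast
  then obtain a where a: "xs = [a]" using single by blast
  obtain ys where "walk_betw {} A B ys" "a \<notin> set ys" using empty by blast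
  then show ?case using xs a by (metis Int_empty_left Int_insert_left_if0 list.set(1,2))
next
  case (insert e E)
  obtain x y where e: "e = (x, y)" by force
  let ?F = "insert (x, y) E"
  show ?case
  proof (cases "\<forall>u. \<exists>xs. walk_betw E A B xs \<and> u \<notin> set xs")
    case True
    then obtain xs ys where "walk_betw E A B xs" "walk_betw E A B ys" "set xs \<inter> set ys = {}"
      using insert.IH[of A B] by blast
    then show ?thesis by (meson subset_insertI walk_betw_mono)
  next
    case False
    \<comment> \<open>The new arc is essential: without it, the single vertex \<open>z\<close>
      separates \<open>A\<close> from \<open>B\<close>.\<close>
    then obtain z where z: "\<And>xs. walk_betw E A B xs \<Longrightarrow> z \<in> set xs" by blast
    have thru: "x \<in> set xs \<and> y \<in> set xs" if "walk_betw ?F A B xs" "z \<notin> set xs" for xs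
    proof -
      have "xs \<noteq> []" using that by (auto simp: walk_betw_def)
      then obtain us q p vs where 1: "xs = us @ [q]" and 2: "xs = p # vs"
        by (metis list.exhaust rev_exhaust)
      have "walk_betw E A B xs" if "x \<notin> set xs"
        using walk_betw_avoid_tail[of x y E A B us q] that \<open>walk_betw ?F A B xs\<close> unfolding 1 by auto
      moreover have "walk_betw E A B xs" if "y \<notin> set xs"
        using walk_betw_avoid_head[of x y E A B p vs] that \<open>walk_betw ?F A B xs\<close> unfolding 2 by auto
      ultimately show ?thesis using z that(2) by blast
    qed
    \<comment> \<open>A walk from \<open>A\<close> to \<open>B\<close> that avoids \<open>u\<close>
      meets \<open>{z, x}\<close>. Cut at the first visit, it does not leave \<open>x\<close> and so
      does not use the new arc. This is the separation hypothesis for the induction on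
      \<open>A\<close> and \<open>{z, x}\<close>; \<open>B'\<close> is the mirror image.\<close>
    have A': "\<exists>xs. walk_betw E A {z, x} xs \<and> u \<notin> set xs" for u
    proof -
      obtain xs where xs: "walk_betw ?F A B xs" "u \<notin> set xs" using insert.prems e by metis
      then have "set xs \<inter> {z, x} \<noteq> {}" using thru by blast
      then obtain us q where "walk_betw ?F A {z, x} (us @ [q])" "set us \<inter> {z, x} = {}"
        "set (us @ [q]) \<subseteq> set xs" using walk_betw_first[OF xs(1)] by metis
      then show ?thesis using xs(2) walk_betw_avoid_tail[of x y E A "{z, x}" us q] by blast
    qed
    have B': "\<exists>xs. walk_betw E {z, y} B xs \<and> u \<notin> set xs" for u
    proof -
      obtain xs where xs: "walk_betw ?F A B xs" "u \<notin> set xs" using insert.prems e by metis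
      then have "set xs \<inter> {z, y} \<noteq> {}" using thru by blast
      then obtain q vs where "walk_betw ?F {z, y} B (q # vs)" "set vs \<inter> {z, y} = {}"
        "set (q # vs) \<subseteq> set xs" using walk_betw_last[OF xs(1)] by metis
      then show ?thesis using xs(2) walk_betw_avoid_head[of x y E "{z, y}" B q vs] by blast
    qed
    obtain us1 us2 where us: "walk_betw E A {z, x} (us1 @ [z])" "walk_betw E A {z, x} (us2 @ [x])"
      "set (us1 @ [z]) \<inter> set (us2 @ [x]) = {}" "z \<notin> set us1"
    proof -
      obtain p1 p2 where p: "walk_betw E A {z, x} p1" "walk_betw E A {z, x} p2" "set p1 \<inter> set p2 = {}"
        using insert.IH[OF A'] by blast
      \<comment> \<open>Cut both walks where they first meet \<open>{z, x}\<close>. Being disjoint,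
        they end in different vertices, so one ends in \<open>z\<close> and the other in
        \<open>x\<close>.\<close>
      have "set p1 \<inter> {z, x} \<noteq> {}" "set p2 \<inter> {z, x} \<noteq> {}"
        using p by (auto simp: walk_betw_def dest: last_in_set)
      then obtain r1 q1 r2 q2 where
        1: "walk_betw E A {z, x} (r1 @ [q1])" "q1 \<in> {z, x}" "set r1 \<inter> {z, x} = {}" "set (r1 @ [q1]) \<subseteq> set p1" and
        2: "walk_betw E A {z, x} (r2 @ [q2])" "q2 \<in> {z, x}" "set r2 \<inter> {z, x} = {}" "set (r2 @ [q2]) \<subseteq> set p2"
        using walk_betw_first[OF p(1)] walk_betw_first[OF p(2)] by metis
      have dj: "set (r1 @ [q1]) \<inter> set (r2 @ [q2]) = {}" using 1 2 p(3) by blast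
      then have "q1 \<noteq> q2" by auto
      then consider "q1 = z" "q2 = x" | "q1 = x" "q2 = z" using 1 2 by blast
      then show thesis
        using 1 2 dj that[of r1 r2] that[of r2 r1] by cases blast+
    qed
    obtain vs1 vs2 where vs: "walk_betw E {z, y} B (z # vs1)" "walk_betw E {z, y} B (y # vs2)"
      "set (z # vs1) \<inter> set (y # vs2) = {}" "z \<notin> set vs1"
    proof -
      obtain p1 p2 where p: "walk_betw E {z, y} B p1" "walk_betw E {z, y} B p2" "set p1 \<inter> set p2 = {}"
        using insert.IH[OF B'] by blast
      have "set p1 \<inter> {z, y} \<noteq> {}" "set p2 \<inter> {z, y} \<noteq> {}"
        using p by (auto simp: walk_betw_def dest: hd_in_set)
      then obtain r1 q1 r2 q2 where
        1: "walk_betw E {z, y} B (q1 # r1)" "q1 \<in> {z, y}" "set r1 \<inter> {z, y} = {}" "set (q1 # r1) \<subseteq> set p1" and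
        2: "walk_betw E {z, y} B (q2 # r2)" "q2 \<in> {z, y}" "set r2 \<inter> {z, y} = {}" "set (q2 # r2) \<subseteq> set p2"
        using walk_betw_last[OF p(1)] walk_betw_last[OF p(2)] by metis
      have dj: "set (q1 # r1) \<inter> set (q2 # r2) = {}" using 1 2 p(3) by blast
      then have "q1 \<noteq> q2" by auto
      then consider "q1 = z" "q2 = y" | "q1 = y" "q2 = z" using 1 2 by blast
      then show thesis
        using 1 2 dj that[of r1 r2] that[of r2 r1] by cases blast+
    qed
    \<comment> \<open>At a common vertex one could switch from \<open>us1\<close> to
      \<open>y # vs2\<close> and reach \<open>B\<close> in \<open>E\<close> without meeting
      \<open>z\<close>.\<close>
    have "set us1 \<inter> set (y # vs2) = {}"
    proof (rule ccontr)
      assume i: "set us1 \<inter> set (y # vs2) \<noteq> {}"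
      then have "us1 \<noteq> []" by auto
      then have "walk_betw E A UNIV us1"
        using us(1) by (auto simp: walk_betw_def successively_append_iff)
      from walk_betw_switch[OF this vs(2) i] show False using z us(4) vs(3) by force
    qed
    moreover have "set (us2 @ [x]) \<inter> set vs1 = {}"
    proof (rule ccontr)
      assume i: "set (us2 @ [x]) \<inter> set vs1 \<noteq> {}"
      then have "vs1 \<noteq> []" by auto
      then have "walk_betw E UNIV B vs1"
        using vs(1) by (auto simp: walk_betw_def successively_Cons)
      from walk_betw_switch[OF us(2) this i] show False using z vs(4) us(3) by force
    qed
    \<comment> \<open>One walk is glued at \<open>z\<close>, the other across the new arc from
      \<open>x\<close> to \<open>y\<close>.\<close>
    ultimately have dj: "set (us1 @ z # vs1) \<inter> set ((us2 @ [x]) @ (y # vs2)) = {}"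
      using us(3) vs(3) by auto
    have "walk_betw E A B (us1 @ z # vs1)"
      using us(1) vs(1) by (auto simp: walk_betw_def successively_append_iff hd_append split: if_splits)
    then have 1: "walk_betw ?F A B (us1 @ z # vs1)" by (rule walk_betw_mono) blast
    have 2: "walk_betw ?F A B ((us2 @ [x]) @ (y # vs2))"
      by (rule walk_betw_append[where B = "{z, x}" and C = "{z, y}"])
        (auto intro: walk_betw_mono[OF us(2)] walk_betw_mono[OF vs(2)])
    show ?thesis using 1 2 dj e by metis
  qed
qed

section \<open>From vertex lists to closed walks, and two cycles through one vertex\<close>

lemma walk_betw_imp_rtrancl:
  assumes "walk_betw E A B xs"
  shows "(hd xs, last xs) \<in> (Restr E (set xs))\<^sup>*"
proof -
  have "xs \<noteq> [] \<Longrightarrow> successively (\<lambda>a b. (a, b) \<in> E) xs \<Longrightarrow> set xs \<subseteq> X \<Longrightarrow>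
    (hd xs, last xs) \<in> (Restr E X)\<^sup>*" for X
  proof (induction xs)
    case (Cons a xs)
    show ?case
    proof (cases "xs = []")
      case False
      then have "(a, hd xs) \<in> Restr E X" "(hd xs, last xs) \<in> (Restr E X)\<^sup>*"
        using Cons by (auto simp: successively_Cons)
      then have "(a, last xs) \<in> (Restr E X)\<^sup>*" by (rule converse_rtrancl_into_rtrancl)
      then show ?thesis using False by simp
    qed simp
  qed simp
  then show ?thesis using assms by (auto simp: walk_betw_def)
qed

lemma rtrancl_imp_walk_betw:
  assumes "(a, b) \<in> (Restr E X)\<^sup>*" "a \<in> X"
  shows "\<exists>xs. walk_betw E {a} {b} xs \<and> set xs \<subseteq> X"
  using assms
proof (induction rule: rtrancl_induct)
  case base
  then have "walk_betw E {a} {a} [a] \<and> set [a] \<subseteq> X" by (auto simp: walk_betw_def)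
  then show ?case by blast
next
  case (step b c)
  then obtain xs where xs: "walk_betw E {a} {b} xs" "set xs \<subseteq> X" by blast
  have "walk_betw E {a} {c} (xs @ [c])"
    using xs step.hyps by (intro walk_betw_append[where C = "{c}"]) (auto simp: walk_betw_def)
  then show ?case using xs step.hyps by (intro exI[of _ "xs @ [c]"]) auto
qed

lemma closed_walk_first_return:
  assumes "(v, v) \<in> R\<^sup>+"
  obtains a b where "(v, a) \<in> R" "(b, v) \<in> R" "(a, b) \<in> (Restr R (- {v}))\<^sup>*" | "(v, v) \<in> R"
proof -
  \<comment> \<open>Invariant for a walk from \<open>v\<close> that currently ends in
    \<open>t\<close>: either it has not yet returned to \<open>v\<close>, or its first return has
    already supplied one of the two conclusions.\<close>
  have "(v, t) \<in> R\<^sup>+ \<Longrightarrow>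
    (t \<noteq> v \<and> (\<exists>a. (v, a) \<in> R \<and> a \<noteq> v \<and> (a, t) \<in> (Restr R (- {v}))\<^sup>*)) \<or>
    (v, v) \<in> R \<or> (\<exists>a b. (v, a) \<in> R \<and> (b, v) \<in> R \<and> (a, b) \<in> (Restr R (- {v}))\<^sup>*)" for t
  proof (induction rule: trancl_induct)
    case (base y)
    then show ?case by blast
  next
    case (step y z)
    show ?case
    proof (cases "y = v \<or> z = v")
      case True
      then show ?thesis using step by blast
    next
      case False
      then have "(y, z) \<in> Restr R (- {v})" using step.hyps by blast
      then show ?thesis using step.IH False by (meson rtrancl.rtrancl_into_rtrancl)
    qed
  qed
  from this[OF assms] show thesis
    using that by (elim disjE conjE exE) simp_all
qed

text \<open>Delete \<open>v\<close> and apply the two-walk Menger theorem from its out-neighbours to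
  its in-neighbours: by \<open>nodom\<close> no single vertex separates them. Each of the two
  disjoint walks closes up through \<open>v\<close>.\<close>

lemma two_cycles_through_vertex:
  assumes fin: "finite E" and "w \<noteq> v"
    and nodom: "\<And>x. x \<noteq> v \<Longrightarrow> (v, v) \<in> (Restr E (- {x}))\<^sup>+"
  shows "\<exists>X Y. \<not> acyclic (Restr E X) \<and> \<not> acyclic (Restr E Y) \<and> X \<inter> Y \<subseteq> {v}"
proof (cases "(v, v) \<in> E")
  case True
  then have "(v, v) \<in> Restr E {v}" by blast
  then have "\<not> acyclic (Restr E {v})" by (auto simp: acyclic_def)
  then show ?thesis by blast
next
  case False
  define E0 where "E0 = Restr E (- {v})"
  define A where "A = E `` {v}"
  define B where "B = E\<inverse> `` {v}"
  have v: "\<exists>xs. walk_betw E0 A B xs \<and> x \<notin> set xs" if "x \<noteq> v" for x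
  proof -
    let ?R = "Restr E (- {x})"
    obtain a b where ab: "(v, a) \<in> ?R" "(b, v) \<in> ?R" "(a, b) \<in> (Restr ?R (- {v}))\<^sup>*"
      using closed_walk_first_return[OF nodom[OF \<open>x \<noteq> v\<close>]] False by blast
    have "Restr ?R (- {v}) = Restr E0 (- {x})" by (auto simp: E0_def)
    then obtain xs where "walk_betw E0 {a} {b} xs" "set xs \<subseteq> - {x}"
      using rtrancl_imp_walk_betw[of a b E0 "- {x}"] ab by auto
    then show ?thesis using ab by (auto simp: walk_betw_def A_def B_def intro!: exI[of _ xs])
  qed
  \<comment> \<open>No arc of \<open>E0\<close> enters \<open>v\<close>, so \<open>v\<close> could
    only be the first vertex; but then \<open>v\<close> would lie in \<open>A\<close>, giving a
    loop.\<close>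
  have vnotin: "v \<notin> set xs" if "walk_betw E0 A B xs" for xs
  proof
    assume "v \<in> set xs"
    then obtain us vs where xs: "xs = us @ v # vs" by (meson split_list)
    have "us = []" using that xs by (auto simp: walk_betw_def E0_def successively_append_iff)
    then show False using that xs False by (auto simp: walk_betw_def A_def)
  qed
  \<comment> \<open>For \<open>x = v\<close> any walk will do, and \<open>w\<close> supplies
    one.\<close>
  have "\<exists>xs. walk_betw E0 A B xs \<and> x \<notin> set xs" for x
    using v v[OF \<open>w \<noteq> v\<close>] vnotin by (cases "x = v") blast+
  moreover have "finite E0" using fin by (auto simp: E0_def)
  ultimately obtain xs ys where xy: "walk_betw E0 A B xs" "walk_betw E0 A B ys" "set xs \<inter> set ys = {}"
    using two_disjoint_walks by blast
  have "\<not> acyclic (Restr E (insert v (set xs)))" if "walk_betw E0 A B xs" for xs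
  proof -
    let ?R = "Restr E (insert v (set xs))"
    have "(hd xs, last xs) \<in> (Restr E0 (set xs))\<^sup>*" using that by (rule walk_betw_imp_rtrancl)
    moreover have "Restr E0 (set xs) \<subseteq> ?R" by (auto simp: E0_def)
    ultimately have "(hd xs, last xs) \<in> ?R\<^sup>*" using rtrancl_mono by blast
    moreover have "(v, hd xs) \<in> ?R" "(last xs, v) \<in> ?R"
      using that by (auto simp: walk_betw_def A_def B_def)
    ultimately have "(v, v) \<in> ?R\<^sup>+"
      by (metis (lifting) rtrancl_into_trancl2 trancl.trancl_into_trancl)
    then show ?thesis by (auto simp: acyclic_def)
  qed
  then have "\<not> acyclic (Restr E (insert v (set xs)))" "\<not> acyclic (Restr E (insert v (set ys)))"
    using xy by blast+
  then show ?thesis using xy(3) by blast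
qed

text \<open>On a finite set the converse of an acyclic relation is well-founded, and a minimal
  element would be a sink.\<close>

lemma not_acyclic_if_no_sink:
  assumes "finite X" "X \<noteq> {}" "\<And>a. a \<in> X \<Longrightarrow> \<exists>b\<in>X. (a, b) \<in> E"
  shows "\<not> acyclic (Restr E X)"
proof
  assume "acyclic (Restr E X)"
  moreover have "finite (Restr E X)" using assms(1) by blast
  ultimately have "wf ((Restr E X)\<inverse>)" by (simp add: finite_acyclic_wf_converse)
  then obtain a where "a \<in> X" "\<And>b. (b, a) \<in> (Restr E X)\<inverse> \<Longrightarrow> b \<notin> X"
    using assms(2) by (metis all_not_in_conv wfE_min)
  then show False using assms(3) by blast
qed

section \<open>Out-degrees at least 2: two cycles sharing at most one vertex\<close>

lemma two_cycles_strongly_connected: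
  assumes "finite V" "V \<noteq> {}" and EV: "E \<subseteq> V \<times> V"
    and out: "\<And>v u. v \<in> V \<Longrightarrow> \<exists>w. (v, w) \<in> E \<and> w \<noteq> u"
    and strong: "\<And>a b. a \<in> V \<Longrightarrow> b \<in> V \<Longrightarrow> (a, b) \<in> E\<^sup>*"
  shows "\<exists>X Y t. \<not> acyclic (Restr E X) \<and> \<not> acyclic (Restr E Y) \<and> X \<inter> Y \<subseteq> {t}"
proof (rule ccontr)
  assume contr: "\<not> ?thesis"
  \<comment> \<open>the vertices that dominate \<open>v\<close>\<close>
  define D where "D v = {x. x \<noteq> v \<and> (v, v) \<notin> (Restr E (- {x}))\<^sup>+}" for v
  have fE: "finite E" using assms(1) EV by (meson finite_SigmaI finite_subset)
  have D_ne: "D v \<noteq> {}" if "v \<in> V" for v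
  proof
    assume "D v = {}"
    then have nodom: "(v, v) \<in> (Restr E (- {x}))\<^sup>+" if "x \<noteq> v" for x
      using that unfolding D_def by blast
    obtain w where "w \<noteq> v" using out[OF \<open>v \<in> V\<close>, of v] by blast
    then obtain X Y where "\<not> acyclic (Restr E X)" "\<not> acyclic (Restr E Y)" "X \<inter> Y \<subseteq> {v}"
      using two_cycles_through_vertex[OF fE _ nodom] by metis
    then show False using contr by meson
  qed
  have D_sub: "D v \<subseteq> V" if "v \<in> V" for v
  proof
    fix x assume x: "x \<in> D v"
    obtain w where "(v, w) \<in> E" using out[OF \<open>v \<in> V\<close>] by blast
    moreover from this have "(w, v) \<in> E\<^sup>*" using strong[of w v] that EV by blast
    ultimately have "(v, v) \<in> E\<^sup>+" by (rule rtrancl_into_trancl2)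
    moreover have "(v, v) \<notin> (Restr E (- {x}))\<^sup>+" using x by (simp add: D_def)
    moreover have "Restr E (- {x}) = E" if "x \<notin> V" using that EV by blast
    ultimately show "x \<in> V" by metis
  qed
  \<comment> \<open>If \<open>y\<close> did not dominate \<open>v\<close>, a closed walk through
    \<open>v\<close> would avoid \<open>y\<close>. It passes through \<open>x\<close>, so started
    from \<open>x\<close> it contradicts that \<open>y\<close> dominates \<open>x\<close>.\<close>
  have D_trans: "D x \<subseteq> insert v (D v)" if x: "x \<in> D v" for v x
  proof
    fix y assume y: "y \<in> D x"
    show "y \<in> insert v (D v)"
    proof (rule ccontr)
      assume n: "y \<notin> insert v (D v)"
      let ?R = "Restr E (- {y})"
      have vv: "(v, v) \<in> ?R\<^sup>+" using n by (auto simp: D_def)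
      have "(v, t) \<in> ?R\<^sup>+ \<Longrightarrow> (v, t) \<in> (Restr E (- {x}))\<^sup>+ \<or> (v, x) \<in> ?R\<^sup>+ \<and> (x, t) \<in> ?R\<^sup>*" for t
      proof (induction rule: trancl_induct)
        case (base t)
        then show ?case using x by (cases "t = x") (auto simp: D_def)
      next
        case (step s t)
        then consider "(v, x) \<in> ?R\<^sup>+" "(x, s) \<in> ?R\<^sup>*" | "(v, s) \<in> (Restr E (- {x}))\<^sup>+" by blast
        then show ?case
        proof cases
          case 1
          with step.hyps(2) have "(x, t) \<in> ?R\<^sup>*" by (blast intro: rtrancl.rtrancl_into_rtrancl)
          with 1 show ?thesis by blast
        next
          case 2
          have "s \<noteq> x" using tranclD2[OF 2] by blast
          show ?thesis
          proof (cases "t = x")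
            case True
            have "(v, t) \<in> ?R\<^sup>+" using step.hyps by (rule trancl.trancl_into_trancl)
            with True show ?thesis by blast
          next
            case False
            then have "(s, t) \<in> Restr E (- {x})" using step.hyps(2) \<open>s \<noteq> x\<close> by blast
            with 2 have "(v, t) \<in> (Restr E (- {x}))\<^sup>+" by (rule trancl.trancl_into_trancl)
            then show ?thesis by blast
          qed
        qed
      qed
      then have "(v, x) \<in> ?R\<^sup>+" "(x, v) \<in> ?R\<^sup>*" using vv x by (auto simp: D_def)
      then have "(x, x) \<in> ?R\<^sup>+" using rtrancl_trancl_trancl by fast
      then show False using y by (auto simp: D_def)
    qed
  qed
  \<comment> \<open>Take \<open>v\<close> with fewest dominators. A dominator \<open>x\<close> not
    dominated by \<open>v\<close> would have strictly fewer, since \<open>D x\<close> lies in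
    \<open>D v\<close> and misses \<open>x\<close>.\<close>
  obtain v where v: "v \<in> V" "\<And>u. u \<in> V \<Longrightarrow> card (D v) \<le> card (D u)"
    using assms(2) ex_has_least_nat[of "\<lambda>v. v \<in> V" _ "\<lambda>v. card (D v)"] by blast
  obtain x where x: "x \<in> D v" using D_ne v by blast
  then have xV: "x \<in> V" using D_sub v by blast
  have vx: "v \<in> D x"
  proof (rule ccontr)
    assume "v \<notin> D x"
    then have "D x \<subseteq> D v - {x}" using D_trans[OF x] by (auto simp: D_def)
    then have "D x \<subset> D v" using x by blast
    moreover have "finite (D v)" using D_sub v assms(1) finite_subset by blast
    ultimately show False using v(2)[OF xV] by (meson leD psubset_card_mono)
  qed
  \<comment> \<open>Nonempty walks are taken, so \<open>a\<close> belongs to \<open>A a b\<close>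
    only if some closed walk through \<open>a\<close> avoids \<open>b\<close>. Mutual domination
    thus keeps \<open>v\<close> and \<open>x\<close> out of both sets.\<close>
  define A where "A a b = {t. (a, t) \<in> (Restr E (- {b}))\<^sup>+}" for a b
  have A_V: "A a b \<subseteq> V" if "a \<in> V" for a b
    using EV tranclD2 unfolding A_def by fast
  have A_closed: "w \<in> insert b (A a b)" if "t \<in> A a b" "(t, w) \<in> E" for a b t w
  proof -
    have at: "(a, t) \<in> (Restr E (- {b}))\<^sup>+" using that by (simp add: A_def)
    then have "t \<noteq> b" using tranclD2 by fast
    then have "(t, w) \<in> Restr E (- {b})" if "w \<noteq> b" using \<open>(t, w) \<in> E\<close> that by blast
    with at have "(a, w) \<in> (Restr E (- {b}))\<^sup>+" if "w \<noteq> b"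
      using that trancl.trancl_into_trancl by fast
    then show ?thesis by (auto simp: A_def)
  qed
  have A_cyc: "\<not> acyclic (Restr E (A a b))" if "a \<in> V" "a \<noteq> b" for a b
  proof (rule not_acyclic_if_no_sink)
    show "finite (A a b)" using A_V assms(1) that finite_subset by blast
    obtain w where "(a, w) \<in> E" "w \<noteq> b" using out \<open>a \<in> V\<close> by blast
    then have "w \<in> A a b" using that by (auto simp: A_def)
    then show "A a b \<noteq> {}" by blast
    fix t assume t: "t \<in> A a b"
    then obtain w where "(t, w) \<in> E" "w \<noteq> b" using out A_V \<open>a \<in> V\<close> by blast
    then show "\<exists>w\<in>A a b. (t, w) \<in> E" using A_closed t by blast
  qed
  have nin: "v \<notin> A v x" "x \<notin> A v x" "v \<notin> A x v" "x \<notin> A x v" "v \<noteq> x"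
    using x vx tranclD2 unfolding A_def D_def by fast+
  \<comment> \<open>Arcs leaving \<open>A v x\<close> end in \<open>x\<close>, those leaving
    \<open>A x v\<close> end in \<open>v\<close>. Neither vertex lies in the other set, so the
    intersection is closed under arcs; if nonempty, it would contain \<open>v\<close> by strong
    connectivity.\<close>
  have "A v x \<inter> A x v = {}"
  proof (rule ccontr)
    assume "A v x \<inter> A x v \<noteq> {}"
    then obtain t where t: "t \<in> A v x \<inter> A x v" by blast
    have "(t, s) \<in> E\<^sup>* \<Longrightarrow> s \<in> A v x \<inter> A x v" for s
    proof (induction rule: rtrancl_induct)
      case (step s r)
      then show ?case using A_closed nin by blast
    qed (use t in blast)
    moreover have "(t, v) \<in> E\<^sup>*" using strong t A_V v by blast
    ultimately show False using nin by blast
  qed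
  moreover have "\<not> acyclic (Restr E (A v x))" "\<not> acyclic (Restr E (A x v))"
    using A_cyc v xV nin by auto
  ultimately show False using contr by blast
qed

text \<open>A smallest reachability set \<open>W\<close> is a strong component that no arc leaves,
  so restricting to it preserves all out-neighbours.\<close>

theorem two_almost_disjoint_cycles:
  assumes "finite V" "V \<noteq> {}" and EV: "E \<subseteq> V \<times> V"
    and out: "\<And>v u. v \<in> V \<Longrightarrow> \<exists>w. (v, w) \<in> E \<and> w \<noteq> u"
  shows "\<exists>X Y t. \<not> acyclic (Restr E X) \<and> \<not> acyclic (Restr E Y) \<and> X \<inter> Y \<subseteq> {t}"
proof -
  obtain v where v: "v \<in> V" "\<And>u. u \<in> V \<Longrightarrow> card (E\<^sup>* `` {v}) \<le> card (E\<^sup>* `` {u})"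
    using assms(2) ex_has_least_nat[of "\<lambda>v. v \<in> V" _ "\<lambda>v. card (E\<^sup>* `` {v})"] by blast
  define W where "W = E\<^sup>* `` {v}"
  have reach: "E\<^sup>* `` {a} \<subseteq> V" if "a \<in> V" for a
    using Image_closed_trancl[of E V] that EV by blast
  have WV: "W \<subseteq> V" using reach v by (auto simp: W_def)
  then have fW: "finite W" using assms(1) finite_subset by blast
  have closed: "b \<in> W" if "a \<in> W" "(a, b) \<in> E" for a b
    using that by (auto simp: W_def)
  \<comment> \<open>What \<open>a\<close> reaches lies in \<open>W\<close> and, by minimality,
    cannot be smaller.\<close>
  have W_eq: "E\<^sup>* `` {a} = W" if "a \<in> W" for a
  proof (rule card_subset_eq[OF fW])
    show sub: "E\<^sup>* `` {a} \<subseteq> W" using that by (auto simp: W_def)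
    show "card (E\<^sup>* `` {a}) = card W"
      using v(2)[of a] card_mono[OF fW sub] that WV by (fastforce simp: W_def)
  qed
  have restr: "(a, b) \<in> (Restr E W)\<^sup>*" if "(a, b) \<in> E\<^sup>*" "a \<in> W" for a b
    using that
  proof (induction rule: rtrancl_induct)
    case (step b c)
    have "b \<in> W" using step.hyps(1) W_eq step.prems by blast
    then have "(b, c) \<in> Restr E W" using closed step.hyps(2) by blast
    then show ?case using step by (meson rtrancl.rtrancl_into_rtrancl)
  qed blast
  have "\<exists>X Y t. \<not> acyclic (Restr (Restr E W) X) \<and> \<not> acyclic (Restr (Restr E W) Y) \<and> X \<inter> Y \<subseteq> {t}"
  proof (rule two_cycles_strongly_connected[OF fW])
    show "W \<noteq> {}" by (auto simp: W_def)
    show "\<exists>w. (a, w) \<in> Restr E W \<and> w \<noteq> u" if "a \<in> W" for a u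
      using out[of a u] closed[of a] that WV by blast
    show "(a, b) \<in> (Restr E W)\<^sup>*" if "a \<in> W" "b \<in> W" for a b
      using restr W_eq that by blast
  qed blast
  moreover have "\<not> acyclic (Restr E X)" if "\<not> acyclic (Restr (Restr E W) X)" for X
    using that acyclic_subset[of "Restr E X" "Restr (Restr E W) X"] by blast
  ultimately show ?thesis by blast
qed

section \<open>Vertices of out-degree 1, handled by twins\<close>

text \<open>Closed walks map to closed walks even when \<open>f\<close> is not injective, which
  allows twins to be merged.\<close>

lemma not_acyclic_image:
  assumes "\<not> acyclic R" "\<And>a b. (a, b) \<in> R \<Longrightarrow> (f a, f b) \<in> S"
  shows "\<not> acyclic S"
proof -
  obtain x where "(x, x) \<in> R\<^sup>+" using assms(1) by (auto simp: acyclic_def)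
  moreover have "(x, y) \<in> R\<^sup>+ \<Longrightarrow> (f x, f y) \<in> S\<^sup>+" for y
    by (induction rule: trancl_induct) (blast intro: assms(2) trancl.trancl_into_trancl)+
  ultimately show ?thesis by (auto simp: acyclic_def)
qed

text \<open>Every vertex of out-degree 1 is given a second out-neighbour, namely a twin of its unique
  out-neighbour \<open>w\<close> with the same out-neighbours as \<open>w\<close>. Projecting back, two cycles that
  share at most one vertex meet at most in one further vertex for each twin.\<close>

theorem two_cycles_small_intersection:
  assumes "finite V" "V \<noteq> {}" and EV: "E \<subseteq> V \<times> V"
    and out: "\<And>v. v \<in> V \<Longrightarrow> E `` {v} \<noteq> {}"
  shows "\<exists>X Y. X \<subseteq> V \<and> Y \<subseteq> V \<and> \<not> acyclic (Restr E X) \<and> \<not> acyclic (Restr E Y) \<and>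
    card (X \<inter> Y) \<le> card {v \<in> V. card (E `` {v}) = 1} + 1"
proof -
  define P where "P = {v \<in> V. card (E `` {v}) = 1}"
  \<comment> \<open>The label \<open>True\<close> marks the twin. Every vertex formally gets one,
    but only vertices of \<open>P\<close> send arcs to twins; both copies of \<open>v\<close> have
    the same out-neighbours.\<close>
  define F where "F = {((v, i :: bool), (w, j)). (v, w) \<in> E \<and> (j \<longrightarrow> v \<in> P)}"
  have "\<exists>X Y t. \<not> acyclic (Restr F X) \<and> \<not> acyclic (Restr F Y) \<and> X \<inter> Y \<subseteq> {t}"
  proof (rule two_almost_disjoint_cycles)
    show "finite (V \<times> (UNIV :: bool set))" using assms(1) by simp
    show "V \<times> (UNIV :: bool set) \<noteq> {}" using assms(2) by simp
    show "F \<subseteq> (V \<times> UNIV) \<times> (V \<times> UNIV)" using EV by (auto simp: F_def)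
    fix a u :: "'a \<times> bool" assume a: "a \<in> V \<times> UNIV"
    obtain v i where vi: "a = (v, i)" "v \<in> V" using a by blast
    obtain w where w: "(v, w) \<in> E" using out vi by blast
    show "\<exists>b. (a, b) \<in> F \<and> b \<noteq> u"
    proof (cases "v \<in> P")
      case True
      then have "(a, (w, j)) \<in> F" for j using w vi by (auto simp: F_def)
      then show ?thesis by (metis prod.inject)
    next
      case False
      have "E `` {v} \<noteq> {fst u}"
        using False vi(2) by (auto simp: P_def)
      then obtain w' where "(v, w') \<in> E" "w' \<noteq> fst u" using w by blast
      then have "(a, (w', False)) \<in> F \<and> (w', False) \<noteq> u" using vi by (auto simp: F_def)
      then show ?thesis by blast
    qed
  qed
  then obtain X Y t where XY: "\<not> acyclic (Restr F X)" "\<not> acyclic (Restr F Y)" "X \<inter> Y \<subseteq> {t}"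
    by blast
  define pr where "pr Z = fst ` (Z \<inter> Range F)" for Z :: "('a \<times> bool) set"
  have cyc: "\<not> acyclic (Restr E (pr Z))" if Z: "\<not> acyclic (Restr F Z)" for Z
  proof -
    obtain x where "(x, x) \<in> (Restr F Z)\<^sup>+" using Z unfolding acyclic_def by blast
    moreover have "(x, y) \<in> (Restr F Z)\<^sup>+ \<Longrightarrow> x \<in> Range F \<Longrightarrow>
      (x, y) \<in> (Restr F (Z \<inter> Range F))\<^sup>+" for y
    proof (induction rule: trancl_induct)
      case (step y z)
      have "(y, z) \<in> Restr F (Z \<inter> Range F)"
        using step.hyps(2) tranclD2[OF step.hyps(1)] by blast
      then show ?case using step by (meson trancl.trancl_into_trancl)
    qed blast
    moreover have "x \<in> Range F" using tranclD2[OF calculation(1)] by blast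
    ultimately have "\<not> acyclic (Restr F (Z \<inter> Range F))" unfolding acyclic_def by blast
    then show ?thesis
      by (rule not_acyclic_image[where f = fst]) (force simp: F_def pr_def)
  qed
  have pr_V: "pr Z \<subseteq> V" for Z using EV by (auto simp: pr_def F_def)
  have fP: "finite P" using assms(1) by (auto simp: P_def)
  define nb where "nb v = (THE w. (v, w) \<in> E)" for v
  have nb: "nb v = w" if v: "v \<in> P" and w: "(v, w) \<in> E" for v w
  proof -
    obtain w' where w': "E `` {v} = {w'}" using v card_1_singletonE[of "E `` {v}"] unfolding P_def by blast
    then have "\<And>u. (v, u) \<in> E \<longleftrightarrow> u = w'" by blast
    then show ?thesis using w by (simp add: nb_def)
  qed
  have twin: "w \<in> nb ` P" if "(w, True) \<in> Range F" for w
    using that nb by (force simp: F_def)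
  have "pr X \<inter> pr Y \<subseteq> insert (fst t) (nb ` P)"
  proof
    fix w assume "w \<in> pr X \<inter> pr Y"
    moreover have "\<exists>i. (w, i) \<in> Z \<and> (w, i) \<in> Range F" if "w \<in> pr Z" for Z
      using that unfolding pr_def image_iff by (metis IntE prod.collapse)
    ultimately obtain i j where "(w, i) \<in> X" "(w, i) \<in> Range F" "(w, j) \<in> Y" "(w, j) \<in> Range F"
      by blast
    then show "w \<in> insert (fst t) (nb ` P)"
      using twin XY(3) by (cases i; cases j) auto
  qed
  then have "card (pr X \<inter> pr Y) \<le> card (insert (fst t) (nb ` P))"
    using fP by (intro card_mono) auto
  also have "\<dots> \<le> card (nb ` P) + 1" by (simp add: card_insert_le_m1 card_insert_if fP)
  also have "\<dots> \<le> card P + 1" using fP by (simp add: card_image_le)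
  finally show ?thesis using cyc XY pr_V unfolding P_def by blast
qed

section \<open>Transfer to digraphs and their arc-list cycles\<close>

text \<open>A closed walk in the subgraph induced by \<open>X\<close> contains a cycle there, and
  the tails of its arcs lie in \<open>X\<close>.\<close>

lemma (in wf_digraph) cycle_in_vertex_set:
  assumes "X \<subseteq> verts G" "\<not> acyclic (Restr (arcs_ends G) X)"
  shows "\<exists>C. cycle C \<and> cycle_verts G C \<subseteq> X"
proof -
  interpret H: wf_digraph "G \<restriction> X" by (rule wellformed_induce_subgraph)
  have "Restr (arcs_ends G) X = arcs_ends (G \<restriction> X)"
    by (auto simp: arcs_ends_conv)
  then obtain u where "u \<rightarrow>\<^sup>+\<^bsub>G \<restriction> X\<^esub> u" using assms(2) by (auto simp: acyclic_def)
  then obtain p where "H.awalk u p u" "p \<noteq> []" using H.reachable1_awalk by blast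
  then have "H.closed_w p" by (auto simp: H.closed_w_def)
  then obtain C where C: "H.cycle C" using H.closed_w_imp_cycle by blast
  then have "cycle C" using subgraph_cycle subgraph_induce_subgraphI assms(1) by blast
  moreover have "set C \<subseteq> arcs (G \<restriction> X)"
    using C by (auto simp: H.cycle_def H.awalk_def)
  ultimately show ?thesis by (auto simp: cycle_verts_def)
qed

text \<open>Without parallel arcs, \<open>head G\<close> is injective on the arcs leaving
  \<open>v\<close>, so counting out-neighbours is counting arcs.\<close>

lemma (in digraph) card_arcs_ends_Image: "card (arcs_ends G `` {v}) = out_degree G v"
proof -
  have "arcs_ends G `` {v} = head G ` out_arcs G v"
    by (auto simp: arcs_ends_conv)
  moreover have "inj_on (head G) (out_arcs G v)"
    using no_multi_arcs by (auto simp: inj_on_def arc_to_ends_def)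
  ultimately show ?thesis by (simp add: out_degree_def card_image)
qed

theorem theorem2p2:
  fixes G :: "('a, 'b) pre_digraph" and n p :: nat
  assumes "digraph G"
    and "card (verts G) = n" and "n \<ge> 1"
    and "\<forall>v \<in> verts G. out_degree G v = 1 \<or> out_degree G v = 2"
    and "p = card {v \<in> verts G. out_degree G v = 1}"
  shows "\<exists>C1 C2. pre_digraph.cycle G C1 \<and> pre_digraph.cycle G C2 \<and>
           card (cycle_verts G C1 \<inter> cycle_verts G C2) \<le> p + 1"
proof -
  interpret digraph G by (rule assms(1))
  have "verts G \<noteq> {}" using assms(2,3) by auto
  moreover have "arcs_ends G \<subseteq> verts G \<times> verts G" by (auto simp: arcs_ends_conv)
  moreover have "arcs_ends G `` {v} \<noteq> {}" if "v \<in> verts G" for v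
    using assms(4) card_arcs_ends_Image[of v] that by fastforce
  ultimately obtain X Y where XY: "X \<subseteq> verts G" "Y \<subseteq> verts G"
    "\<not> acyclic (Restr (arcs_ends G) X)" "\<not> acyclic (Restr (arcs_ends G) Y)"
    "card (X \<inter> Y) \<le> p + 1"
    using two_cycles_small_intersection[of "verts G" "arcs_ends G"]
    by (auto simp: card_arcs_ends_Image assms(5))
  obtain C1 C2 where C: "cycle C1" "cycle_verts G C1 \<subseteq> X" "cycle C2" "cycle_verts G C2 \<subseteq> Y"
    using cycle_in_vertex_set XY by meson
  have "finite (X \<inter> Y)" using XY(1) finite_verts finite_subset by blast
  then have "card (cycle_verts G C1 \<inter> cycle_verts G C2) \<le> card (X \<inter> Y)"
    using C by (intro card_mono) auto
  then show ?thesis using C XY(5) by (meson le_trans)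
qed

end
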